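(* (i) If $\gamma_j=0$ and $e_j^TR=0$ for some $j\in\{1,\dots,n\}$, then for every $\nu\in\mathbb{R}^k$ with $\nu\ge 0$ (entrywise) the system $M\ddot q(t)+D(\nu)\dot q(t)+Kq(t)=0$ is not stable. (ii) If $\gamma_j=0$ and $e_j^TR_\nu=0$ for some $j\in\{1,\dots,n\}$ and some $\nu\in\mathbb{R}^k$ with $\nu\ge 0$, then the system $M\ddot q(t)+D(\nu)\dot q(t)+Kq(t)=0$ is not stable for this particular $\nu$.
   Context: $M,K\in\mathbb{R}^{n\times n}$ are symmetric positive definite. The damping matrix is $D(\nu)=D_{\mathrm{int}}+D_{\mathrm{ext}}(\nu)$, where $D_{\mathrm{int}}\in\mathbb{R}^{n\times n}$ is symmetric positive semidefinite with $D_{\mathrm{int}}M^{-1}K=KM^{-1}D_{\mathrm{int}}$, and $D_{\mathrm{ext}}(\nu)=\sum_{i=1}^k\nu_iD_iD_i^T$ with $D_i\in\mathbb{R}^{n\times r_i}$ given full rank matrices; $k_d=\sum_{i=1}^k r_i$. Let $\Phi\in\mathbb{R}^{n\times n}$ be a nonsingular matrix that simultaneously diagonalizes $M,K,D_{\mathrm{int}}$ by congruence: $\Phi^TM\Phi=I_n$, $\Phi^TK\Phi=\Omega^2$ with $\Omega=\mathrm{diag}(\omega_1,\dots,\omega_n)$, all $\omega_i>0$, and $\Phi^TD_{\mathrm{int}}\Phi=\Gamma=\mathrm{diag}(\gamma_1,\dots,\gamma_n)$. Define $R=\Phi^T[D_1\ \cdots\ D_k]\in\mathbb{R}^{n\times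 k_d}$, $\Sigma_\nu=\mathrm{diag}(\nu_1I_{r_1},\dots,\nu_kI_{r_k})\in\mathbb{R}^{k_d\times k_d}$ and $R_\nu=R\,\Sigma_\nu^{1/2}$. $e_j$ is the $j$th standard unit vector of $\mathbb{R}^n$. The system is called stable if all eigenvalues of $Q_\nu(\lambda)=\lambda^2M+\lambda D(\nu)+K$, i.e. all $\lambda_0\in\mathbb{C}$ for which $Q_\nu(\lambda_0)$ is singular, have strictly negative real part. *)

theory Defs
  imports
    Complex_Main
    "Jordan_Normal_Form.Matrix"
    "Jordan_Normal_Form.DL_Rank"
    "Jordan_Normal_Form.Gauss_Jordan_Elimination"
begin

definition sym_pos_def :: "nat \<Rightarrow> real mat \<Rightarrow> bool" where
  "sym_pos_def n A \<longleftrightarrow> A \<in> carrier_mat n n \<and> A\<^sup>T = A \<and>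
     (\<forall>x \<in> carrier_vec n. x \<noteq> 0\<^sub>v n \<longrightarrow> x \<bullet> (A *\<^sub>v x) > 0)"

definition sym_pos_semidef :: "nat \<Rightarrow> real mat \<Rightarrow> bool" where
  "sym_pos_semidef n A \<longleftrightarrow> A \<in> carrier_mat n n \<and> A\<^sup>T = A \<and>
     (\<forall>x \<in> carrier_vec n. x \<bullet> (A *\<^sub>v x) \<ge> 0)"

definition full_rank :: "real mat \<Rightarrow> bool" where
  "full_rank A \<longleftrightarrow> vec_space.rank (dim_row A) A = min (dim_row A) (dim_col A)"

(* Families indexed by i = 1, ..., k in the mathematics are indexed by i < k here:
   the i-th block D i has r i columns, and nu is a vector of dimension k.
   The matrix type is not a monoid (dimensions vary), so the sum is taken entrywise. *)
definition D_ext :: "nat \<Rightarrow> nat \<Rightarrow> (nat \<Rightarrow> real mat) \<Rightarrow> real vec \<Rightarrow> real mat" where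
  "D_ext n k D \<nu> = mat n n (\<lambda>ab. \<Sum>i<k. (\<nu> $ i \<cdot>\<^sub>m (D i * (D i)\<^sup>T)) $$ ab)"

definition damping :: "nat \<Rightarrow> nat \<Rightarrow> real mat \<Rightarrow> (nat \<Rightarrow> real mat) \<Rightarrow> real vec \<Rightarrow> real mat" where
  "damping n k Dint D \<nu> = Dint + D_ext n k D \<nu>"

(* Juxtaposition [D 0 ... D (k-1)]: the columns of all blocks, in order. *)
definition hcat_blocks :: "nat \<Rightarrow> nat \<Rightarrow> (nat \<Rightarrow> real mat) \<Rightarrow> real mat" where
  "hcat_blocks n k D = mat_of_cols n (concat (map (\<lambda>i. cols (D i)) [0..<k]))"

definition R_mat :: "nat \<Rightarrow> nat \<Rightarrow> real mat \<Rightarrow> (nat \<Rightarrow> real mat) \<Rightarrow> real mat" where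
  "R_mat n k \<Phi> D = \<Phi>\<^sup>T * hcat_blocks n k D"

definition Sigma_mat :: "nat \<Rightarrow> (nat \<Rightarrow> nat) \<Rightarrow> real vec \<Rightarrow> real mat" where
  "Sigma_mat k r \<nu> = diag_block_mat (map (\<lambda>i. \<nu> $ i \<cdot>\<^sub>m 1\<^sub>m (r i)) [0..<k])"

(* The positive semidefinite square root of Sigma_mat, for entrywise nonnegative nu;
   see Sigma_sqrt_square and Sigma_sqrt_nonneg_diagonal. *)
definition Sigma_sqrt :: "nat \<Rightarrow> (nat \<Rightarrow> nat) \<Rightarrow> real vec \<Rightarrow> real mat" where
  "Sigma_sqrt k r \<nu> = diag_block_mat (map (\<lambda>i. sqrt (\<nu> $ i) \<cdot>\<^sub>m 1\<^sub>m (r i)) [0..<k])"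

definition R_nu_mat ::
  "nat \<Rightarrow> nat \<Rightarrow> (nat \<Rightarrow> nat) \<Rightarrow> real mat \<Rightarrow> (nat \<Rightarrow> real mat) \<Rightarrow> real vec \<Rightarrow> real mat" where
  "R_nu_mat n k r \<Phi> D \<nu> = R_mat n k \<Phi> D * Sigma_sqrt k r \<nu>"

(* Q(z) = z^2 A + z B + C, as a complex matrix. *)
definition quad_pencil :: "real mat \<Rightarrow> real mat \<Rightarrow> real mat \<Rightarrow> complex \<Rightarrow> complex mat" where
  "quad_pencil A B C z =
     z\<^sup>2 \<cdot>\<^sub>m map_mat complex_of_real A + z \<cdot>\<^sub>m map_mat complex_of_real B + map_mat complex_of_real C"

definition quad_eigenvalue :: "real mat \<Rightarrow> real mat \<Rightarrow> real mat \<Rightarrow> complex \<Rightarrow> bool" where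
  "quad_eigenvalue A B C z \<longleftrightarrow> \<not> invertible_mat (quad_pencil A B C z)"

(* Stability of the system A q'' + B q' + C q = 0. *)
definition stable_system :: "real mat \<Rightarrow> real mat \<Rightarrow> real mat \<Rightarrow> bool" where
  "stable_system A B C \<longleftrightarrow> (\<forall>z. quad_eigenvalue A B C z \<longrightarrow> Re z < 0)"

lemma hcat_blocks_carrier:
  assumes "\<And>i. i < k \<Longrightarrow> D i \<in> carrier_mat n (r i)"
  shows "hcat_blocks n k D \<in> carrier_mat n (\<Sum>i<k. r i)"
proof -
  have "length (cols (D i)) = r i" if "i < k" for i
    unfolding cols_length by (rule carrier_matD(2)[OF assms[OF that]])
  then have "map (\<lambda>i. length (cols (D i))) [0..<k] = map r [0..<k]"
    by (intro map_cong) (simp_all only: set_upt atLeastLessThan_iff)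
  moreover have "sum_list (map r [0..<k]) = (\<Sum>i<k. r i)"
    by (simp add: interv_sum_list_conv_sum_set_nat atLeast0LessThan)
  ultimately show ?thesis
    unfolding hcat_blocks_def
    by (intro carrier_matI) (simp_all only: mat_of_cols_carrier length_concat map_map comp_def)
qed

lemma Sigma_carrier: "Sigma_mat k r \<nu> \<in> carrier_mat (\<Sum>i<k. r i) (\<Sum>i<k. r i)"
proof -
  have "sum_list (map r [0..<k]) = (\<Sum>i<k. r i)"
    by (simp add: interv_sum_list_conv_sum_set_nat atLeast0LessThan)
  then show ?thesis
    unfolding Sigma_mat_def
    by (intro carrier_matI) (simp_all only: dim_diag_block_mat map_map comp_def
        index_smult_mat index_one_mat)
qed

lemma Sigma_sqrt_square:
  assumes "0\<^sub>v k \<le> \<nu>"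
  shows "Sigma_sqrt k r \<nu> ^\<^sub>m 2 = Sigma_mat k r \<nu>"
proof -
  let ?f = "\<lambda>i. sqrt (\<nu> $ i) \<cdot>\<^sub>m 1\<^sub>m (r i)"
  have "?f i ^\<^sub>m 2 = \<nu> $ i \<cdot>\<^sub>m 1\<^sub>m (r i)" if "i < k" for i
  proof -
    have "0 \<le> \<nu> $ i" using assms that by (auto simp: less_eq_vec_def)
    then have "?f i * ?f i = \<nu> $ i \<cdot>\<^sub>m 1\<^sub>m (r i)"
      by (subst mult_smult_assoc_mat[of _ "r i" "r i" _ "r i"], simp, simp,
          subst mult_smult_distrib[of _ "r i" "r i" _ "r i"], simp, simp)
        (intro eq_matI; simp)
    then show ?thesis by (simp add: numeral_2_eq_2)
  qed
  then show ?thesis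
    unfolding Sigma_sqrt_def Sigma_mat_def
    by (subst diag_block_pow_mat) (auto intro!: arg_cong[of _ _ diag_block_mat])
qed

lemma Sigma_sqrt_nonneg_diagonal:
  assumes "0\<^sub>v k \<le> \<nu>"
  shows "diagonal_mat (Sigma_sqrt k r \<nu>)" "\<forall>x \<in> elements_mat (Sigma_sqrt k r \<nu>). 0 \<le> x"
proof -
  have "diagonal_mat (diag_block_mat As)"
    if "\<forall>A \<in> set As. square_mat A \<and> diagonal_mat A" for As :: "real mat list"
    using that
  proof (induction As)
    case Nil
    then show ?case by (simp add: diagonal_mat_def)
  next
    case (Cons A As)
    have "square_mat (diag_block_mat As)" using Cons.prems by (intro diag_block_mat_square) auto
    with Cons show ?case by (auto simp: diagonal_mat_def Let_def)
  qed
  moreover have "diagonal_mat (c \<cdot>\<^sub>m 1\<^sub>m m)" for c :: real and m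
    by (auto simp: diagonal_mat_def)
  ultimately show "diagonal_mat (Sigma_sqrt k r \<nu>)" unfolding Sigma_sqrt_def by auto
  have "\<forall>i<k. 0 \<le> \<nu> $ i" using assms by (auto simp: less_eq_vec_def)
  then have blocks: "0 \<le> x"
    if "i < k" "x \<in> elements_mat (sqrt (\<nu> $ i) \<cdot>\<^sub>m 1\<^sub>m (r i))" for i x
    using that by (auto simp: elements_mat_def)
  show "\<forall>x \<in> elements_mat (Sigma_sqrt k r \<nu>). 0 \<le> x"
  proof
    fix x
    assume "x \<in> elements_mat (Sigma_sqrt k r \<nu>)"
    then have "x \<in> {0} \<union> \<Union> (set (map elements_mat
        (map (\<lambda>i. sqrt (\<nu> $ i) \<cdot>\<^sub>m 1\<^sub>m (r i)) [0..<k])))"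
      unfolding Sigma_sqrt_def by (rule subsetD[OF elements_diag_block_mat])
    then consider "x = 0"
      | i where "i < k" "x \<in> elements_mat (sqrt (\<nu> $ i) \<cdot>\<^sub>m 1\<^sub>m (r i))"
      by (simp only: set_map set_upt Un_iff Union_iff image_iff Bex_def singleton_iff
          atLeastLessThan_iff) blast
    then show "0 \<le> x" using blocks by cases auto
  qed
qed

end

(* The mode v = \<Phi> e_j is undamped: \<gamma>_j = 0 gives Dint v = 0, and e_j^T R_\<nu> = 0 says that each D_i with
   \<nu>_i > 0 satisfies D_i^T v = 0. Since K v = \<omega>_j^2 M v, the purely imaginary number i \<omega>_j is an
   eigenvalue of the pencil. Part (i) reduces to part (ii), as R_\<nu> = R \<Sigma>_\<nu>^(1/2). *)
theory Submission
  imports Defs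
begin

section \<open>Block columns: juxtaposition, scaling and the external damping\<close>

lemma mat_of_cols_cols_append:
  assumes "A \<in> carrier_mat n m"
  shows "mat_of_cols n (cols A @ vs) =
    four_block_mat A (mat_of_cols n vs) (0\<^sub>m 0 m) (0\<^sub>m 0 (length vs))"
  using assms by (intro eq_matI) (auto simp: mat_of_cols_def nth_append)

text \<open>Induction on the list of blocks: the zero off-diagonal blocks of
  \<open>diag_block_mat\<close> keep the columns of different \<open>A i\<close> from
  mixing.\<close>

lemma mat_of_cols_concat_mult_diag_block_mat:
  fixes A B :: "'b \<Rightarrow> 'a :: semiring_1 mat"
  assumes "\<And>i. i \<in> set is \<Longrightarrow> A i \<in> carrier_mat n (r i)"
    and "\<And>i. i \<in> set is \<Longrightarrow> B i \<in> carrier_mat (r i) (s i)"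
  shows "mat_of_cols n (concat (map (\<lambda>i. cols (A i)) is)) * diag_block_mat (map B is) =
    mat_of_cols n (concat (map (\<lambda>i. cols (A i * B i)) is))"
  using assms
proof (induction "is")
  case Nil
  then show ?case by (intro eq_matI) auto
next
  case (Cons i "is")
  define vs where "vs = concat (map (\<lambda>i. cols (A i)) is)"
  define ws where "ws = concat (map (\<lambda>i. cols (A i * B i)) is)"
  define S where "S = diag_block_mat (map B is)"
  have A: "A i \<in> carrier_mat n (r i)" and B: "B i \<in> carrier_mat (r i) (s i)"
    using Cons.prems by auto
  have IH: "mat_of_cols n vs * S = mat_of_cols n ws"
    unfolding vs_def S_def ws_def using Cons by simp
  have len: "length vs = dim_row S"
  proof -
    have "map (\<lambda>i. length (cols (A i))) is = map (\<lambda>i. dim_row (B i)) is"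
      using Cons.prems by fastforce
    then show ?thesis
      unfolding vs_def S_def length_concat dim_diag_block_mat map_map comp_def by (rule arg_cong)
  qed
  \<comment> \<open>A product has as many columns as its right factor, so the induction hypothesis
    also gives the width of \<open>S\<close>.\<close>
  have "dim_col S = length ws" using arg_cong[OF IH, of dim_col] by simp
  then have S: "S \<in> carrier_mat (length vs) (length ws)" using len by auto
  have vs: "mat_of_cols n vs \<in> carrier_mat n (length vs)" by simp
  \<comment> \<open>Lower blocks with 0 rows turn the juxtaposition into a four-block matrix, the
    form in which \<open>diag_block_mat\<close> unfolds, so that the 2x2 block product rule
    applies.\<close>
  have "mat_of_cols n (cols (A i) @ vs) * diag_block_mat (B i # map B is) =
    four_block_mat (A i) (mat_of_cols n vs) (0\<^sub>m 0 (r i)) (0\<^sub>m 0 (length vs)) *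
    four_block_mat (B i) (0\<^sub>m (r i) (length ws)) (0\<^sub>m (length vs) (s i)) S"
    using B S by (simp add: mat_of_cols_cols_append[OF A] Let_def S_def)
  also have "\<dots> = four_block_mat (A i * B i) (mat_of_cols n ws) (0\<^sub>m 0 (s i)) (0\<^sub>m 0 (length ws))"
    using A B S IH vs
    by (simp add: mult_four_block_mat[OF A vs zero_carrier_mat zero_carrier_mat B
          zero_carrier_mat zero_carrier_mat S])
  also have "\<dots> = mat_of_cols n (cols (A i * B i) @ ws)"
    by (rule mat_of_cols_cols_append[symmetric]) (use A B in auto)
  finally show ?case by (simp add: vs_def ws_def)
qed

text \<open>The diagonal blocks are multiples of the identity, so each one only scales its own D_i.
  This turns a condition on R_\<nu> into conditions on the single blocks.\<close>

lemma hcat_blocks_mult_Sigma_sqrt: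
  assumes "\<And>i. i < k \<Longrightarrow> D i \<in> carrier_mat n (r i)"
  shows "hcat_blocks n k D * Sigma_sqrt k r \<nu> = hcat_blocks n k (\<lambda>i. sqrt (\<nu> $ i) \<cdot>\<^sub>m D i)"
proof -
  have "D i * (sqrt (\<nu> $ i) \<cdot>\<^sub>m 1\<^sub>m (r i)) = sqrt (\<nu> $ i) \<cdot>\<^sub>m D i" if "i < k" for i
    by (subst mult_smult_distrib[OF assms[OF that], of _ "r i"]) (use assms[OF that] in auto)
  then have blocks: "map (\<lambda>i. cols (D i * (sqrt (\<nu> $ i) \<cdot>\<^sub>m 1\<^sub>m (r i)))) [0..<k] =
      map (\<lambda>i. cols (sqrt (\<nu> $ i) \<cdot>\<^sub>m D i)) [0..<k]"
    by simp
  then show ?thesis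
    unfolding hcat_blocks_def Sigma_sqrt_def
    by (subst mat_of_cols_concat_mult_diag_block_mat[where r = r and s = r])
      (use assms in \<open>auto simp only: blocks set_upt atLeastLessThan_iff intro!: smult_carrier_mat one_carrier_mat\<close>)
qed

text \<open>The entries of the row are the scalar products of \<open>w\<close> with the columns of
  all blocks; those belonging to block \<open>i\<close> are the components of
  \<open>(D i)\<^sup>T *\<^sub>v w\<close>.\<close>

lemma row_mult_hcat_blocks_eq_0:
  assumes D: "\<And>i. i < k \<Longrightarrow> D i \<in> carrier_mat n (r i)"
    and w: "w \<in> carrier_vec n"
    and zero: "mat_of_rows n [w] * hcat_blocks n k D = 0\<^sub>m 1 m"
    and i: "i < k"
  shows "(D i)\<^sup>T *\<^sub>v w = 0\<^sub>v (r i)"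
proof -
  define vs where "vs = concat (map (\<lambda>i. cols (D i)) [0..<k])"
  have "v \<bullet> w = 0" if v_in: "v \<in> set vs" for v
  proof -
    obtain c where c: "c < length vs" "vs ! c = v"
      using v_in unfolding in_set_conv_nth by blast
    have v: "v \<in> carrier_vec n"
      using v_in D by (fastforce simp: vs_def cols_def)
    \<comment> \<open>The width \<open>m\<close> is arbitrary in the statement; the equation of
      matrices forces it to be the number of columns.\<close>
    have "m = length vs"
      using arg_cong[OF zero, of dim_col] by (simp add: hcat_blocks_def vs_def)
    then have "(mat_of_rows n [w] * mat_of_cols n vs) $$ (0, c) = 0"
      using zero c by (simp add: hcat_blocks_def vs_def)
    then show ?thesis
      using c v w by (simp add: comm_scalar_prod[OF v w])
  qed
  moreover have "col (D i) c \<in> set vs" if "c < r i" for c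
    using i that D[OF i] by (force simp: vs_def cols_def)
  ultimately show ?thesis
    using D[OF i] by (intro eq_vecI) auto
qed

text \<open>The i-th summand sends v to \<nu>_i D_i (D_i^T v), where either the scalar or the vector
  D_i^T v is zero.\<close>

lemma D_ext_mult_vec_eq_0:
  assumes D: "\<And>i. i < k \<Longrightarrow> D i \<in> carrier_mat n (r i)"
    and v: "v \<in> carrier_vec n"
    and zero: "\<And>i. i < k \<Longrightarrow> \<nu> $ i \<noteq> 0 \<Longrightarrow> (D i)\<^sup>T *\<^sub>v v = 0\<^sub>v (r i)"
  shows "D_ext n k D \<nu> *\<^sub>v v = 0\<^sub>v n"
proof (rule eq_vecI)
  fix a
  assume "a < dim_vec (0\<^sub>v n :: real vec)"
  then have a: "a < n" by simp
  let ?B = "\<lambda>i. \<nu> $ i \<cdot>\<^sub>m (D i * (D i)\<^sup>T)"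
  have "(\<Sum>b<n. ?B i $$ (a, b) * v $ b) = 0" if i: "i < k" for i
  proof -
    \<comment> \<open>For a general \<open>P\<close>, so that the product
      \<open>D i * (D i)\<^sup>T\<close> stays folded until associativity is applied to it.\<close>
    have entries: "(\<Sum>b<n. (c \<cdot>\<^sub>m P) $$ (a, b) * v $ b) = c * (P *\<^sub>v v) $ a"
      if "P \<in> carrier_mat n n" for P and c :: real
      using that v a by (simp add: scalar_prod_def sum_distrib_left mult.assoc atLeast0LessThan)
    have "(\<Sum>b<n. ?B i $$ (a, b) * v $ b) = \<nu> $ i * ((D i * (D i)\<^sup>T) *\<^sub>v v) $ a"
      by (rule entries) (use D[OF i] in simp)
    also have "(D i * (D i)\<^sup>T) *\<^sub>v v = D i *\<^sub>v ((D i)\<^sup>T *\<^sub>v v)"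
      by (rule assoc_mult_mat_vec[of _ n "r i" _ n]) (use D[OF i] v in auto)
    also have "\<nu> $ i * (D i *\<^sub>v ((D i)\<^sup>T *\<^sub>v v)) $ a = 0"
      using zero[OF i] D[OF i] a by (cases "\<nu> $ i = 0") (auto simp: scalar_prod_def)
    finally show ?thesis .
  qed
  \<comment> \<open>\<open>D_ext\<close> is an entrywise sum, so the sum over blocks starts out
    inside the sum over columns. After the swap each inner sum is the contribution of one block,
    shown above to be 0.\<close>
  moreover have "(D_ext n k D \<nu> *\<^sub>v v) $ a = (\<Sum>b<n. \<Sum>i<k. ?B i $$ (a, b) * v $ b)"
    using a v by (simp add: D_ext_def scalar_prod_def sum_distrib_right atLeast0LessThan)
  then have "(D_ext n k D \<nu> *\<^sub>v v) $ a = (\<Sum>i<k. \<Sum>b<n. ?B i $$ (a, b) * v $ b)"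
    by (subst (asm) sum.swap)
  ultimately show "(D_ext n k D \<nu> *\<^sub>v v) $ a = 0\<^sub>v n $ a"
    using a by simp
qed (simp add: D_ext_def)

section \<open>Invertibility, kernels and eigenvalues of the pencil\<close>

lemma invertible_mat_mult_vec_eq_0:
  assumes A: "A \<in> carrier_mat n n" and "invertible_mat A"
    and v: "v \<in> carrier_vec n" and zero: "A *\<^sub>v v = 0\<^sub>v n"
  shows "v = 0\<^sub>v n"
proof -
  obtain B where B: "A * B = 1\<^sub>m n" "B * A = 1\<^sub>m (dim_row B)"
    using assms by (auto simp: invertible_mat_def inverts_mat_def)
  \<comment> \<open>The shape of the inverse is read off by comparing the column counts on both
    sides of the two product equations.\<close>
  have "dim_row B = n" "dim_col B = n"
    using arg_cong[OF B(1), of dim_col] arg_cong[OF B(2), of dim_col] A by auto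
  then have B_carrier: "B \<in> carrier_mat n n" by auto
  have "v = (B * A) *\<^sub>v v" using B B_carrier v by simp
  also have "\<dots> = B *\<^sub>v (A *\<^sub>v v)" by (rule assoc_mult_mat_vec[OF B_carrier A v])
  also have "\<dots> = 0\<^sub>v n" using B_carrier zero by (auto simp: scalar_prod_def)
  finally show ?thesis .
qed

lemma invertible_mat_transpose:
  fixes A :: "'a :: comm_semiring_1 mat"
  assumes A: "A \<in> carrier_mat n n" and "invertible_mat A"
  shows "invertible_mat A\<^sup>T"
proof -
  obtain B where B: "A * B = 1\<^sub>m n" "B * A = 1\<^sub>m (dim_row B)"
    using assms by (auto simp: invertible_mat_def inverts_mat_def)
  have "dim_row B = n" "dim_col B = n"
    using arg_cong[OF B(1), of dim_col] arg_cong[OF B(2), of dim_col] A by auto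
  then have B_carrier: "B \<in> carrier_mat n n" by auto
  then have "A\<^sup>T * B\<^sup>T = 1\<^sub>m n" "B\<^sup>T * A\<^sup>T = 1\<^sub>m n"
    using B by (simp_all add: transpose_mult[OF A B_carrier, symmetric]
        transpose_mult[OF B_carrier A, symmetric])
  then show ?thesis
    using A B_carrier unfolding invertible_mat_def inverts_mat_def by auto
qed

text \<open>At z = i \<omega> the terms z^2 A v and C v cancel and z B v is 0, so the complexified
  \<open>v\<close> lies in the kernel of the pencil. Stability fails because Re z = 0 is not
  strictly negative.\<close>

lemma undamped_mode_not_stable:
  fixes A B C :: "real mat"
  assumes carrier: "A \<in> carrier_mat n n" "B \<in> carrier_mat n n" "C \<in> carrier_mat n n"
    and v: "v \<in> carrier_vec n" "v \<noteq> 0\<^sub>v n"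
    and Bv: "B *\<^sub>v v = 0\<^sub>v n" and Cv: "C *\<^sub>v v = \<omega>\<^sup>2 \<cdot>\<^sub>v (A *\<^sub>v v)"
  shows "\<not> stable_system A B C"
proof -
  define z where "z = \<i> * complex_of_real \<omega>"
  let ?h = "map_mat complex_of_real" and ?v = "map_vec complex_of_real v"
  have v': "?v \<in> carrier_vec n" using v by simp
  have Q: "quad_pencil A B C z \<in> carrier_mat n n"
    using carrier by (simp add: quad_pencil_def)
  have "quad_pencil A B C z *\<^sub>v ?v = z\<^sup>2 \<cdot>\<^sub>v (?h A *\<^sub>v ?v) + z \<cdot>\<^sub>v (?h B *\<^sub>v ?v) + ?h C *\<^sub>v ?v"
    unfolding quad_pencil_def using carrier v'
    by (subst add_mult_distrib_mat_vec[of _ n n], auto,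
        subst add_mult_distrib_mat_vec[of _ n n], auto)
  also have "\<dots> = 0\<^sub>v n"
  proof (rule eq_vecI)
    have z2: "z\<^sup>2 = - complex_of_real (\<omega>\<^sup>2)" by (simp add: z_def power_mult_distrib)
    have h: "?h X *\<^sub>v ?v = map_vec complex_of_real (X *\<^sub>v v)" if "X \<in> carrier_mat n n" for X
      by (rule of_real_hom.mult_mat_vec_hom[OF that v(1), symmetric])
    fix a
    assume "a < dim_vec (0\<^sub>v n :: complex vec)"
    then show "(z\<^sup>2 \<cdot>\<^sub>v (?h A *\<^sub>v ?v) + z \<cdot>\<^sub>v (?h B *\<^sub>v ?v) + ?h C *\<^sub>v ?v) $ a = 0\<^sub>v n $ a"
      unfolding h[OF carrier(1)] h[OF carrier(2)] h[OF carrier(3)] Bv Cv z2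
      using carrier by simp
  qed (use carrier in simp)
  finally have zero: "quad_pencil A B C z *\<^sub>v ?v = 0\<^sub>v n" .
  have "?v \<noteq> 0\<^sub>v n"
    using v by (auto simp: vec_eq_iff)
  then have "quad_eigenvalue A B C z"
    using invertible_mat_mult_vec_eq_0[OF Q _ v' zero] unfolding quad_eigenvalue_def by blast
  moreover have "\<not> Re z < 0" by (simp add: z_def)
  ultimately show ?thesis unfolding stable_system_def by blast
qed

theorem mainTheorem2:
  fixes n k :: nat
    and r :: "nat \<Rightarrow> nat"
    and M K Dint \<Phi> :: "real mat"
    and D :: "nat \<Rightarrow> real mat"
    and \<omega> \<gamma> :: "nat \<Rightarrow> real"
  assumes M: "sym_pos_def n M"
    and K: "sym_pos_def n K"
    and Dint: "sym_pos_semidef n Dint"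
    and comm: "Dint * the (mat_inverse M) * K = K * the (mat_inverse M) * Dint"
    and D: "\<And>i. i < k \<Longrightarrow> D i \<in> carrier_mat n (r i)"
    and D_full_rank: "\<And>i. i < k \<Longrightarrow> full_rank (D i)"
    and \<Phi>: "\<Phi> \<in> carrier_mat n n" "invertible_mat \<Phi>"
    and \<Phi>M: "\<Phi>\<^sup>T * M * \<Phi> = 1\<^sub>m n"
    and \<Phi>K: "\<Phi>\<^sup>T * K * \<Phi> = mat_diag n \<omega> ^\<^sub>m 2"
    and \<omega>: "\<And>i. i < n \<Longrightarrow> \<omega> i > 0"
    and \<Phi>Dint: "\<Phi>\<^sup>T * Dint * \<Phi> = mat_diag n \<gamma>"
  shows
    "((\<exists>j<n. \<gamma> j = 0 \<and>
         mat_of_rows n [unit_vec n j] * R_mat n k \<Phi> D = 0\<^sub>m 1 (\<Sum>i<k. r i)) \<longrightarrow>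
       (\<forall>\<nu> \<in> carrier_vec k. 0\<^sub>v k \<le> \<nu> \<longrightarrow> \<not> stable_system M (damping n k Dint D \<nu>) K)) \<and>
     (\<forall>\<nu> \<in> carrier_vec k. 0\<^sub>v k \<le> \<nu> \<longrightarrow>
       (\<exists>j<n. \<gamma> j = 0 \<and>
         mat_of_rows n [unit_vec n j] * R_nu_mat n k r \<Phi> D \<nu> = 0\<^sub>m 1 (\<Sum>i<k. r i)) \<longrightarrow>
       \<not> stable_system M (damping n k Dint D \<nu>) K)"
proof -
  have \<Phi>t: "\<Phi>\<^sup>T \<in> carrier_mat n n" using \<Phi> by simp
  note M_carrier = M[unfolded sym_pos_def_def, THEN conjunct1]
  note K_carrier = K[unfolded sym_pos_def_def, THEN conjunct1]
  note Dint_carrier = Dint[unfolded sym_pos_semidef_def, THEN conjunct1]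
  have hcat: "hcat_blocks n k D \<in> carrier_mat n (\<Sum>i<k. r i)"
    by (rule hcat_blocks_carrier) (rule D)
  then have R: "R_mat n k \<Phi> D \<in> carrier_mat n (\<Sum>i<k. r i)"
    unfolding R_mat_def using \<Phi>t by simp
  \<comment> \<open>The dimensions depend only on the block sizes and not on the scalars, so they
    agree with those of \<open>Sigma_mat\<close> at any vector.\<close>
  have Sqrt: "Sigma_sqrt k r \<nu> \<in> carrier_mat (\<Sum>i<k. r i) (\<Sum>i<k. r i)" for \<nu>
    using Sigma_carrier[of k r "map_vec sqrt \<nu>"]
    unfolding Sigma_sqrt_def Sigma_mat_def
    by (auto simp: dim_diag_block_mat comp_def interv_sum_list_conv_sum_set_nat atLeast0LessThan)
  have row_carrier: "mat_of_rows n [unit_vec n j] \<in> carrier_mat 1 n" for j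
    by (intro carrier_matI) simp_all
  have not_stable: "\<not> stable_system M (damping n k Dint D \<nu>) K"
    if j: "j < n" and \<gamma>j: "\<gamma> j = 0" and \<nu>: "0\<^sub>v k \<le> \<nu>"
      and row: "mat_of_rows n [unit_vec n j] * R_nu_mat n k r \<Phi> D \<nu> = 0\<^sub>m 1 (\<Sum>i<k. r i)" for j \<nu>
  proof -
    define v where "v = \<Phi> *\<^sub>v unit_vec n j"
    have v: "v \<in> carrier_vec n" using \<Phi> by (simp add: v_def)
    \<comment> \<open>As v = \<Phi> e_j, the left side is column j of the diagonal matrix \<Phi>^T A
      \<Phi>. It is used for \<open>M\<close> (\<open>f\<close> constantly 1), \<open>K\<close>
      (squares of \<omega>) and \<open>Dint\<close> (\<open>f\<close> equal to \<gamma>).\<close>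
    have congruence: "\<Phi>\<^sup>T *\<^sub>v (A *\<^sub>v v) = d \<cdot>\<^sub>v unit_vec n j"
      if A: "A \<in> carrier_mat n n" and eq: "\<Phi>\<^sup>T * A * \<Phi> = mat_diag n f" and d: "f j = d" for A f d
    proof -
      have "\<Phi>\<^sup>T *\<^sub>v (A *\<^sub>v v) = (\<Phi>\<^sup>T * A * \<Phi>) *\<^sub>v unit_vec n j"
        unfolding v_def
        using assoc_mult_mat_vec[OF \<Phi>t, of "A * \<Phi>" n] assoc_mult_mat_vec[OF A \<Phi>(1)]
          assoc_mult_mat[OF \<Phi>t A \<Phi>(1)] A \<Phi>(1)
        by simp
      then show ?thesis
        using j d unfolding eq by (auto simp: mat_diag_def)
    qed
    \<comment> \<open>Lets equations between vectors be checked after applying \<Phi>^T, where the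
      congruences give multiples of e_j.\<close>
    have \<Phi>t_inj: "x = 0\<^sub>v n" if "x \<in> carrier_vec n" "\<Phi>\<^sup>T *\<^sub>v x = 0\<^sub>v n" for x
      using invertible_mat_mult_vec_eq_0[OF \<Phi>t invertible_mat_transpose[OF \<Phi>] that] .
    have Mv: "\<Phi>\<^sup>T *\<^sub>v (M *\<^sub>v v) = unit_vec n j"
      using congruence[OF M_carrier, of "\<lambda>_. 1" 1] \<Phi>M by simp
    have "mat_diag n \<omega> ^\<^sub>m 2 = mat_diag n (\<lambda>i. (\<omega> i)\<^sup>2)"
      by (simp add: numeral_2_eq_2)
    then have Kv': "\<Phi>\<^sup>T *\<^sub>v (K *\<^sub>v v) = (\<omega> j)\<^sup>2 \<cdot>\<^sub>v unit_vec n j"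
      using congruence[OF K_carrier] \<Phi>K by simp
    have Kv: "K *\<^sub>v v = (\<omega> j)\<^sup>2 \<cdot>\<^sub>v (M *\<^sub>v v)"
    proof -
      have Mc: "M *\<^sub>v v \<in> carrier_vec n" and Kc: "K *\<^sub>v v \<in> carrier_vec n"
        using M_carrier K_carrier v by auto
      have "\<Phi>\<^sup>T *\<^sub>v (K *\<^sub>v v - (\<omega> j)\<^sup>2 \<cdot>\<^sub>v (M *\<^sub>v v)) = 0\<^sub>v n"
        using Mc Kc
        by (simp add: mult_minus_distrib_mat_vec[OF \<Phi>t] mult_mat_vec[OF \<Phi>t] Kv' Mv)
      then have *: "K *\<^sub>v v - (\<omega> j)\<^sup>2 \<cdot>\<^sub>v (M *\<^sub>v v) = 0\<^sub>v n"
        using \<Phi>t_inj Mc Kc by simp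
      have "(K *\<^sub>v v) $ a = ((\<omega> j)\<^sup>2 \<cdot>\<^sub>v (M *\<^sub>v v)) $ a" if "a < n" for a
        using arg_cong[OF *, of "\<lambda>x. x $ a"] M_carrier Mc Kc that by simp
      then show ?thesis using M_carrier K_carrier by (intro eq_vecI) simp_all
    qed
    \<comment> \<open>If v vanished, so would \<Phi>^T M v, which is e_j.\<close>
    have v0: "v \<noteq> 0\<^sub>v n"
    proof
      assume "v = 0\<^sub>v n"
      then have "\<Phi>\<^sup>T *\<^sub>v (M *\<^sub>v v) = 0\<^sub>v n"
        using M_carrier \<Phi>t by (auto simp: scalar_prod_def)
      then show False using Mv j by (metis index_unit_vec(2) index_zero_vec(1) zero_neq_one)
    qed
    have "\<Phi>\<^sup>T *\<^sub>v (Dint *\<^sub>v v) = 0\<^sub>v n"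
      using congruence[OF Dint_carrier \<Phi>Dint \<gamma>j] by auto
    then have Dint_v: "Dint *\<^sub>v v = 0\<^sub>v n"
      using \<Phi>t_inj Dint_carrier v by simp
    \<comment> \<open>Regrouping the factors exposes e_j^T \<Phi>^T = v^T on the left and the scaled
      blocks on the right, so the hypothesis says that v is orthogonal to every column of each
      sqrt(\<nu>_i) D_i.\<close>
    have "mat_of_rows n [unit_vec n j] * R_nu_mat n k r \<Phi> D \<nu> =
        (mat_of_rows n [unit_vec n j] * \<Phi>\<^sup>T) * (hcat_blocks n k D * Sigma_sqrt k r \<nu>)"
      unfolding R_nu_mat_def R_mat_def assoc_mult_mat[OF \<Phi>t hcat Sqrt]
      by (rule assoc_mult_mat[OF row_carrier \<Phi>t mult_carrier_mat[OF hcat Sqrt], symmetric])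
    also have "mat_of_rows n [unit_vec n j] * \<Phi>\<^sup>T = mat_of_rows n [v]"
      using \<Phi> j v by (intro eq_matI) (auto simp: v_def mat_of_rows_index)
    also have "hcat_blocks n k D * Sigma_sqrt k r \<nu> = hcat_blocks n k (\<lambda>i. sqrt (\<nu> $ i) \<cdot>\<^sub>m D i)"
      by (rule hcat_blocks_mult_Sigma_sqrt) (rule D)
    finally have hcat_row:
      "mat_of_rows n [v] * hcat_blocks n k (\<lambda>i. sqrt (\<nu> $ i) \<cdot>\<^sub>m D i) = 0\<^sub>m 1 (\<Sum>i<k. r i)"
      using row by simp
    \<comment> \<open>A nonzero \<nu>_i has a nonzero square root, which can be cancelled.\<close>
    have "(D i)\<^sup>T *\<^sub>v v = 0\<^sub>v (r i)" if i: "i < k" and nz: "\<nu> $ i \<noteq> 0" for i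
    proof (rule eq_vecI)
      have "(sqrt (\<nu> $ i) \<cdot>\<^sub>m D i)\<^sup>T *\<^sub>v v = 0\<^sub>v (r i)"
        by (rule row_mult_hcat_blocks_eq_0[OF _ v hcat_row i, where r = r]) (use D in auto)
      moreover fix c
      assume "c < dim_vec (0\<^sub>v (r i) :: real vec)"
      ultimately show "((D i)\<^sup>T *\<^sub>v v) $ c = 0\<^sub>v (r i) $ c"
        using D[OF i] v nz by (auto simp: vec_eq_iff)
    qed (use D[OF i] in simp)
    then have "D_ext n k D \<nu> *\<^sub>v v = 0\<^sub>v n"
      by (intro D_ext_mult_vec_eq_0[where r = r] D v)
    moreover have D_ext_carrier: "D_ext n k D \<nu> \<in> carrier_mat n n"
      by (simp add: D_ext_def)
    ultimately have "damping n k Dint D \<nu> *\<^sub>v v = 0\<^sub>v n"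
      using Dint_v by (simp add: damping_def add_mult_distrib_mat_vec[OF Dint_carrier _ v])
    moreover have "damping n k Dint D \<nu> \<in> carrier_mat n n"
      using Dint_carrier D_ext_carrier by (simp add: damping_def)
    ultimately show ?thesis
      using undamped_mode_not_stable[OF M_carrier _ K_carrier v v0 _ Kv] by blast
  qed
  \<comment> \<open>A zero row stays zero under right multiplication by
    \<open>Sigma_sqrt k r \<nu>\<close>, so a single \<open>j\<close> serves for every \<nu> in part
    (i).\<close>
  have "mat_of_rows n [unit_vec n j] * R_nu_mat n k r \<Phi> D \<nu> = 0\<^sub>m 1 (\<Sum>i<k. r i)"
    if "mat_of_rows n [unit_vec n j] * R_mat n k \<Phi> D = 0\<^sub>m 1 (\<Sum>i<k. r i)" for j \<nu>
    unfolding R_nu_mat_def assoc_mult_mat[OF row_carrier R Sqrt, symmetric] that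
    by (rule left_mult_zero_mat[OF Sqrt])
  then show ?thesis using not_stable by blast
qed

end
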